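(* Let $B=\{b_k(x)\}_{k=0}^\infty$ be a simple set of polynomials. The set of $B$-multiplier sequences coincides with the set of classical multiplier sequences if and only if there exists a real number $\alpha>1$ such that $\{\alpha^k\}_{k=0}^\infty$ and $\{(1/\alpha)^k\}_{k=0}^\infty$ are both $B$-multiplier sequences.
   Context: All polynomials have real coefficients. A simple set of polynomials is a sequence $Q=\{q_k(x)\}_{k=0}^\infty$ of real polynomials with $\deg q_k=k$ for $k=0,1,2,\ldots$ (so $q_0$ is a nonzero constant, and $Q$ is a basis of $\mathbb{R}[x]$). A polynomial "has only real zeros" if it has no non-real complex zeros or is identically zero (nonzero constants also qualify). A sequence of real numbers $\{\gamma_k\}_{k=0}^\infty$ is a $Q$-multiplier sequence if, for every $n$ and all real $a_0,\ldots,a_n$, the polynomial $\sum_{k=0}^n a_k\gamma_k q_k(x)$ has only real zeros whenever $\sum_{k=0}^n a_k q_k(x)$ has only real zeros. A classical multiplier sequence is a $Q$-multiplier sequence for the standard basis $Q=\{x^k\}_{k=0}^\infty$. *)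

theory Defs
  imports Complex_Main "HOL-Computational_Algebra.Polynomial"
begin

(* The condition q k \<noteq> 0 only matters for k = 0, since the zero polynomial has degree 0 here. *)
definition simple_set :: "(nat \<Rightarrow> real poly) \<Rightarrow> bool" where
  "simple_set q \<longleftrightarrow> (\<forall>k. q k \<noteq> 0 \<and> degree (q k) = k)"

definition only_real_zeros :: "real poly \<Rightarrow> bool" where
  "only_real_zeros p \<longleftrightarrow>
     p = 0 \<or> (\<forall>z::complex. poly (map_poly of_real p) z = 0 \<longrightarrow> z \<in> \<real>)"

definition multiplier_sequence :: "(nat \<Rightarrow> real poly) \<Rightarrow> (nat \<Rightarrow> real) \<Rightarrow> bool" where
  "multiplier_sequence q \<gamma> \<longleftrightarrow>
     (\<forall>(n::nat) (a::nat \<Rightarrow> real).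
        only_real_zeros (\<Sum>k\<le>n. smult (a k) (q k)) \<longrightarrow>
        only_real_zeros (\<Sum>k\<le>n. smult (a k * \<gamma> k) (q k)))"

definition classical_multiplier_sequence :: "(nat \<Rightarrow> real) \<Rightarrow> bool" where
  "classical_multiplier_sequence \<gamma> \<longleftrightarrow> multiplier_sequence (\<lambda>k. monom 1 k) \<gamma>"

end

theory Submission
  imports Defs "HOL-Computational_Algebra.Fundamental_Theorem_Algebra"
begin

text \<open>
  Multiplier sequences of a simple set are unchanged when each polynomial is rescaled by a
  nonzero constant and one common affine substitution is made in the variable
  (\<open>multiplier_sequence_affine\<close>). This gives the existence of \<open>\<alpha>\<close> at once when the two sets of
  multiplier sequences agree, because \<open>\<mu> ^ k\<close> acts on the standard basis as the substitution of
  \<open>\<mu> x\<close> for \<open>x\<close>. It also reduces the converse to the claim that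
  \<open>b k = c k * (x - \<beta>) ^ k\<close> for constants \<open>c k\<close> and \<open>\<beta>\<close>. After normalisation, \<open>b\<close> becomes a set \<open>q\<close>
  of monic polynomials with \<open>q 1 = x\<close>, and the claim is that \<open>q n = x ^ n\<close>.

  The proof is by induction on \<open>n\<close>. Write \<open>q n = x ^ n + r\<close> with \<open>degree r < n\<close>. Applying the
  multipliers \<open>\<mu> ^ k\<close> to a monic real-rooted \<open>p\<close> of degree \<open>n\<close>, expanded in the \<open>q k\<close>, and then
  replacing \<open>x\<close> by \<open>x / \<mu>\<close> yields \<open>p + \<sigma>\<close>, where \<open>\<sigma>\<close> has coefficients
  \<open>(\<mu> ^ (n - k) - 1) * r k\<close> and does not depend on \<open>p\<close>
  (\<open>geometric_multiplier_perturbs_real_rooted\<close>). So adding \<open>\<sigma>\<close> preserves real-rootedness, and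
  this forces \<open>\<sigma> = 0\<close>, hence \<open>r = 0\<close>, as soon as the coefficient of \<open>x ^ (n - 2)\<close> in \<open>\<sigma>\<close> is
  nonnegative (\<open>real_rootedness_preserving_perturbation_eq_0\<close>). That coefficient has opposite
  signs for \<open>\<mu> = \<alpha>\<close> and \<open>\<mu> = 1 / \<alpha>\<close>, so one of the two always qualifies. This is where both
  geometric sequences enter.
\<close>

section \<open>Real-rooted polynomials\<close>

abbreviation cpoly :: "real poly \<Rightarrow> complex \<Rightarrow> complex" where
  "cpoly p z \<equiv> poly (map_poly of_real p) z"

lemma cpoly_pCons [simp]: "cpoly (pCons a p) z = of_real a + z * cpoly p z"
  by (simp add: map_poly_pCons)

lemma cpoly_add [simp]: "cpoly (p + q) z = cpoly p z + cpoly q z"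
  by (induction p q rule: poly_induct2) (simp_all add: algebra_simps)

lemma cpoly_smult [simp]: "cpoly (smult c p) z = of_real c * cpoly p z"
  by (induction p) (simp_all add: algebra_simps)

lemma cpoly_mult [simp]: "cpoly (p * q) z = cpoly p z * cpoly q z"
  by (induction p) (simp_all add: algebra_simps)

lemma cpoly_pcompose [simp]: "cpoly (pcompose p q) z = cpoly p (cpoly q z)"
  by (induction p) (simp_all add: pcompose_pCons)

lemma cpoly_of_real: "cpoly p (of_real x) = of_real (poly p x)"
  by (induction p) simp_all

lemma only_real_zeros_mult:
  assumes "only_real_zeros p" "only_real_zeros q"
  shows "only_real_zeros (p * q)"
  using assms by (auto simp: only_real_zeros_def)

lemma only_real_zeros_linear: "only_real_zeros [:- x, 1:]"
  by (auto simp: only_real_zeros_def add_eq_0_iff)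

lemma only_real_zeros_one: "only_real_zeros 1"
  by (auto simp: only_real_zeros_def)

lemma only_real_zeros_power:
  "only_real_zeros p \<Longrightarrow> only_real_zeros (p ^ n)"
  by (induction n) (simp_all add: only_real_zeros_mult only_real_zeros_one)

lemma only_real_zeros_monom: "only_real_zeros (monom 1 n)"
  using only_real_zeros_power[OF only_real_zeros_linear[of 0], of n]
  by (simp add: monom_altdef)

lemma only_real_zeros_factor:
  assumes "only_real_zeros (p * q)" "p * q \<noteq> 0"
  shows "only_real_zeros q"
  using assms by (auto simp: only_real_zeros_def)

lemma only_real_zeros_pcompose_linear:
  assumes "only_real_zeros p" and "v \<noteq> 0"
  shows "only_real_zeros (pcompose p [:u, v:])"
proof -
  have "z \<in> \<real>" if "cpoly (pcompose p [:u, v:]) z = 0" and "p \<noteq> 0" for z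
  proof -
    have "of_real u + z * of_real v \<in> \<real>"
      using that assms(1) by (simp add: only_real_zeros_def)
    then have "((of_real u + z * of_real v) - of_real u) / of_real v \<in> \<real>"
      by (intro Reals_divide Reals_diff) simp_all
    then show ?thesis using assms(2) by simp
  qed
  then show ?thesis
    unfolding only_real_zeros_def by (metis pcompose_0)
qed

text \<open>
  Every root supplied by the fundamental theorem of algebra is real, so linear factors can be
  split off over the reals.
\<close>

lemma only_real_zeros_splits:
  assumes "only_real_zeros p" and "lead_coeff p = 1"
  shows "\<exists>xs. length xs = degree p \<and> p = (\<Prod>x\<leftarrow>xs. [:- x, 1:])"
  using assms
proof (induction "degree p" arbitrary: p)
  case 0
  then have "p = 1"
    by (metis degree_eq_zeroE lead_coeff_pCons(2) one_pCons)
  then show ?case by (intro exI[of _ "[]"]) simp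
next
  case (Suc n)
  have "degree (map_poly complex_of_real p) = degree p"
    by (simp add: degree_map_poly)
  then have "\<not> constant (poly (map_poly complex_of_real p))"
    using Suc.hyps(2) constant_degree[of "map_poly complex_of_real p"] by simp
  then obtain z where z: "cpoly p z = 0"
    using fundamental_theorem_of_algebra by blast
  moreover have "p \<noteq> 0" using Suc.prems(2) by auto
  ultimately have "z \<in> \<real>"
    using Suc.prems(1) by (auto simp: only_real_zeros_def)
  then obtain x where "z = of_real x" by (auto elim: Reals_cases)
  then have "poly p x = 0" using z cpoly_of_real[of p x] by simp
  then obtain q where q: "p = [:- x, 1:] * q"
    by (auto simp: poly_eq_0_iff_dvd elim: dvdE)
  then have "q \<noteq> 0" using \<open>p \<noteq> 0\<close> by auto
  then have "degree p = Suc (degree q)"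
    unfolding q by (subst degree_mult_eq) auto
  moreover have "lead_coeff q = 1"
    using Suc.prems(2) unfolding q lead_coeff_mult by simp
  moreover have "only_real_zeros q"
    using Suc.prems(1) \<open>p \<noteq> 0\<close> unfolding q by (rule only_real_zeros_factor)
  ultimately obtain xs where "length xs = degree q" "q = (\<Prod>x\<leftarrow>xs. [:- x, 1:])"
    using Suc.hyps by auto
  then show ?case
    using q \<open>degree p = Suc (degree q)\<close> by (intro exI[of _ "x # xs"]) simp
qed

text \<open>
  Vieta's formulas for the first two elementary symmetric functions. The factors are reversed,
  \<open>1 - x t\<close> instead of \<open>t - x\<close>, so that the relevant coefficients sit at the fixed positions
  1 and 2.
\<close>

lemma coeffs_prod_list_one_minus:
  fixes xs :: "real list"
  defines "p \<equiv> (\<Prod>x\<leftarrow>xs. [:1, - x:])"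
  shows "coeff p 0 = 1" "coeff p 1 = - sum_list xs"
    and "2 * coeff p 2 = (sum_list xs)\<^sup>2 - (\<Sum>x\<leftarrow>xs. x\<^sup>2)"
proof -
  have "coeff p 0 = 1 \<and> coeff p 1 = - sum_list xs \<and>
      2 * coeff p 2 = (sum_list xs)\<^sup>2 - (\<Sum>x\<leftarrow>xs. x\<^sup>2)"
    unfolding p_def
    by (induction xs)
       (auto simp: coeff_pCons numeral_2_eq_2 algebra_simps power2_eq_square)
  then show "coeff p 0 = 1" "coeff p 1 = - sum_list xs"
    "2 * coeff p 2 = (sum_list xs)\<^sup>2 - (\<Sum>x\<leftarrow>xs. x\<^sup>2)"
    by auto
qed

text \<open>
  By Vieta the squares of the roots add up to \<open>e\<^sub>1\<^sup>2 - 2 * e\<^sub>2\<close>. Here \<open>e\<^sub>1 = 0\<close> and \<open>e\<^sub>2 \<ge> 0\<close>, so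
  every root vanishes.
\<close>

lemma only_real_zeros_eq_monom:
  assumes "only_real_zeros p" and "lead_coeff p = 1" and "degree p = m + 2"
    and "coeff p (m + 1) = 0" and "coeff p m \<ge> 0"
  shows "p = monom 1 (m + 2)"
proof -
  obtain xs where len: "length xs = m + 2" and p: "p = (\<Prod>x\<leftarrow>xs. [:- x, 1:])"
    using only_real_zeros_splits[OF assms(1,2)] assms(3) by auto
  have "reflect_poly [:- x, 1:] = [:1, - x:]" for x :: real
    by (simp add: reflect_poly_pCons' monom_altdef one_pCons)
  then have refl: "reflect_poly p = (\<Prod>x\<leftarrow>xs. [:1, - x:])"
    unfolding p reflect_poly_prod_list by (simp add: o_def)
  have "sum_list xs = 0"
    using coeffs_prod_list_one_minus(2)[of xs] assms(3,4)
    unfolding refl[symmetric] coeff_reflect_poly by simp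
  moreover have "2 * coeff p m = (sum_list xs)\<^sup>2 - (\<Sum>x\<leftarrow>xs. x\<^sup>2)"
    using coeffs_prod_list_one_minus(3)[of xs] assms(3)
    unfolding refl[symmetric] coeff_reflect_poly by simp
  ultimately have "(\<Sum>x\<leftarrow>xs. x\<^sup>2) \<le> 0" using assms(5) by simp
  then have "(\<Sum>x\<leftarrow>xs. x\<^sup>2) = 0"
    by (intro antisym sum_list_nonneg) auto
  then have "\<forall>x\<in>set xs. x = 0"
    by (subst (asm) sum_list_nonneg_eq_0_iff) auto
  then have "xs = replicate (m + 2) 0"
    using len by (intro replicate_eqI) auto
  then show ?thesis
    unfolding p by (simp add: monom_altdef)
qed

section \<open>Rigidity under lower-order perturbations\<close>

text \<open>
  Two test polynomials suffice. Let \<open>c\<close> be the coefficient of \<open>x ^ (m + 1)\<close> in \<open>\<sigma>\<close>. Adding \<open>\<sigma>\<close> to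
  \<open>x ^ (m + 1) * (x - c)\<close> cancels the term of degree \<open>m + 1\<close>, so the root-square identity makes
  the sum a pure power, which leaves \<open>\<sigma> = c * x ^ (m + 1)\<close>. Adding this to
  \<open>x ^ m * (x - c / 2)\<^sup>2\<close> gives \<open>x ^ m * (x\<^sup>2 + c\<^sup>2 / 4)\<close>, which has the roots \<open>\<plusminus> \<i> * c / 2\<close>.
\<close>

lemma real_rootedness_preserving_perturbation_eq_0:
  fixes \<sigma> :: "real poly"
  assumes deg: "degree \<sigma> < m + 2" and nonneg: "coeff \<sigma> m \<ge> 0"
    and pres: "\<And>p. degree p = m + 2 \<Longrightarrow> lead_coeff p = 1 \<Longrightarrow> only_real_zeros p
                 \<Longrightarrow> only_real_zeros (p + \<sigma>)"
  shows "\<sigma> = 0"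
proof -
  define c where "c = coeff \<sigma> (m + 1)"
  have mon: "degree (p + \<sigma>) = m + 2 \<and> lead_coeff (p + \<sigma>) = 1"
    if "degree p = m + 2" "lead_coeff p = 1" for p
    using that deg by (simp add: degree_add_eq_left coeff_eq_0)
  have deg_mult: "degree (monom 1 i * q) = i + j \<and> lead_coeff (monom 1 i * q) = 1"
    if "degree q = j" "lead_coeff q = 1" for i j and q :: "real poly"
  proof -
    have "q \<noteq> 0" using that(2) by auto
    then show ?thesis
      using that by (simp add: degree_mult_eq degree_monom_eq coeff_monom_mult)
  qed
  define p where "p = monom 1 (m + 1) * [:- c, 1:]"
  have p: "degree p = m + 2" "lead_coeff p = 1"
    unfolding p_def using deg_mult[of "[:- c, 1:]" 1 "m + 1"] by simp_all
  have p_alt: "p = monom 1 (m + 2) - monom c (m + 1)"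
    unfolding p_def by (simp add: monom_altdef algebra_simps)
  have "only_real_zeros p"
    unfolding p_def
    by (intro only_real_zeros_mult only_real_zeros_monom only_real_zeros_linear)
  then have "only_real_zeros (p + \<sigma>)" using p pres by blast
  then have "p + \<sigma> = monom 1 (m + 2)"
    using mon[OF p] nonneg by (intro only_real_zeros_eq_monom) (auto simp: p_alt c_def)
  then have \<sigma>: "\<sigma> = monom c (m + 1)"
    unfolding p_alt by (simp add: algebra_simps)
  define q where "q = monom 1 m * [:- (c / 2), 1:] ^ 2"
  have square: "[:- (c / 2), 1:] ^ 2 = [:c\<^sup>2 / 4, - c, 1:]"
    by (simp add: power2_eq_square)
  have "degree q = m + 2" "lead_coeff q = 1"
    unfolding q_def square using deg_mult[of "[:c\<^sup>2 / 4, - c, 1:]" 2 m]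
    by (simp_all add: numeral_2_eq_2)
  moreover have "only_real_zeros q"
    unfolding q_def
    by (intro only_real_zeros_mult only_real_zeros_power only_real_zeros_monom
        only_real_zeros_linear)
  ultimately have "only_real_zeros (q + \<sigma>)" and "q + \<sigma> \<noteq> 0"
    using pres mon[of q] by auto
  moreover have "q + \<sigma> = monom 1 m * [:c\<^sup>2 / 4, 0, 1:]"
    unfolding q_def square \<sigma> by (simp add: monom_altdef algebra_simps)
  ultimately have "only_real_zeros [:c\<^sup>2 / 4, 0, 1:]"
    by (metis only_real_zeros_factor)
  moreover have "cpoly [:c\<^sup>2 / 4, 0, 1:] (\<i> * of_real (c / 2)) = 0"
    by (simp add: complex_eq_iff power2_eq_square)
  ultimately have "\<i> * of_real (c / 2) \<in> \<real>"
    unfolding only_real_zeros_def by (metis pCons_eq_0_iff zero_neq_one)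
  then have "c = 0" by (auto simp: complex_is_Real_iff)
  then show ?thesis using \<sigma> by simp
qed

section \<open>Geometric multiplier sequences determine the basis\<close>

text \<open>
  The multipliers \<open>\<mu> ^ k\<close> scale \<open>q n = x ^ n + r\<close> as a whole by \<open>\<mu> ^ n\<close>, whereas the substitution
  of \<open>\<mu> x\<close> for \<open>x\<close> scales the term of degree \<open>k\<close> in \<open>r\<close> by \<open>\<mu> ^ k\<close>. The perturbation of \<open>p\<close> is
  this discrepancy, measured after undoing the substitution.
\<close>

lemma geometric_multiplier_perturbs_real_rooted:
  fixes q :: "nat \<Rightarrow> real poly"
  assumes mult: "multiplier_sequence q (\<lambda>k. \<mu> ^ k)" and "\<mu> \<noteq> 0"
    and low: "\<And>k. k < n \<Longrightarrow> q k = monom 1 k"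
    and top: "q n = monom 1 n + r" and deg: "\<And>k. k \<ge> n \<Longrightarrow> coeff r k = 0"
    and p: "degree p = n" "lead_coeff p = 1" "only_real_zeros p"
  shows "only_real_zeros (p + (\<Sum>k<n. monom ((\<mu> ^ (n - k) - 1) * coeff r k) k))"
proof -
  (* The coordinates of p with respect to the basis q. *)
  define a where "a k = (if k = n then 1 else coeff p k - coeff r k)" for k
  have coeffs: "coeff (\<Sum>k\<le>n. smult (a k * g k) (q k)) j =
     (if j < n then a j * g j + g n * coeff r j else if j = n then g n else 0)" for g j
  proof -
    have "(\<Sum>k\<le>n. smult (a k * g k) (q k)) = 
      (\<Sum>k<n. smult (a k * g k) (q k)) + smult (a n * g n) (q n)"
      by (simp add: lessThan_Suc_atMost[symmetric])
    also have "(\<Sum>k<n. smult (a k * g k) (q k)) = (\<Sum>k<n. monom (a k * g k) k)"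
      by (intro sum.cong) (auto simp: low smult_monom)
    finally show ?thesis
      using deg[of j] by (auto simp: top coeff_sum a_def)
  qed
  have "(\<Sum>k\<le>n. smult (a k) (q k)) = p"
  proof (rule poly_eqI)
    fix j show "coeff (\<Sum>k\<le>n. smult (a k) (q k)) j = coeff p j"
      using coeffs[of "\<lambda>_. 1" j] p(1,2) by (auto simp: a_def coeff_eq_0)
  qed
  then have "only_real_zeros (\<Sum>k\<le>n. smult (a k * \<mu> ^ k) (q k))"
    using mult p(3) unfolding multiplier_sequence_def by metis
  then have "only_real_zeros (pcompose (\<Sum>k\<le>n. smult (a k * \<mu> ^ k) (q k)) [:0, 1 / \<mu>:])"
    using \<open>\<mu> \<noteq> 0\<close> by (intro only_real_zeros_pcompose_linear) auto
  also have "pcompose (\<Sum>k\<le>n. smult (a k * \<mu> ^ k) (q k)) [:0, 1 / \<mu>:] =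
      p + (\<Sum>k<n. monom ((\<mu> ^ (n - k) - 1) * coeff r k) k)"
  proof (rule poly_eqI)
    fix j
    have rhs: "coeff (\<Sum>k<n. monom ((\<mu> ^ (n - k) - 1) * coeff r k) k) j =
        (if j < n then (\<mu> ^ (n - j) - 1) * coeff r j else 0)"
      by (simp add: coeff_sum)
    have lhs: "(1 / \<mu>) ^ j * (a j * \<mu> ^ j + \<mu> ^ n * coeff r j) =
        coeff p j + (\<mu> ^ (n - j) - 1) * coeff r j" if "j < n"
    proof -
      have "\<mu> ^ n = \<mu> ^ (n - j) * \<mu> ^ j"
        using that by (simp add: power_add[symmetric])
      then have "(1 / \<mu>) ^ j * (a j * \<mu> ^ j + \<mu> ^ n * coeff r j) =
          ((1 / \<mu>) ^ j * \<mu> ^ j) * (a j + \<mu> ^ (n - j) * coeff r j)"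
        by (simp only: distrib_left mult_ac)
      also have "(1 / \<mu>) ^ j * \<mu> ^ j = 1"
        using \<open>\<mu> \<noteq> 0\<close> by (simp add: power_one_over)
      finally have "(1 / \<mu>) ^ j * (a j * \<mu> ^ j + \<mu> ^ n * coeff r j) =
          a j + \<mu> ^ (n - j) * coeff r j"
        by simp
      then show ?thesis
        using that by (simp add: a_def algebra_simps)
    qed
    have unit: "(1 / \<mu>) ^ n * \<mu> ^ n = 1"
      using \<open>\<mu> \<noteq> 0\<close> by (simp add: power_one_over)
    consider "j < n" | "j = n" | "j > n" by linarith
    then show "coeff (pcompose (\<Sum>k\<le>n. smult (a k * \<mu> ^ k) (q k)) [:0, 1 / \<mu>:]) j =
      coeff (p + (\<Sum>k<n. monom ((\<mu> ^ (n - k) - 1) * coeff r k) k)) j"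
    proof cases
      case 1
      then show ?thesis
        by (simp only: coeff_pcompose_linear coeffs coeff_add rhs lhs if_True)
    next
      case 2
      then show ?thesis
        using unit p(1,2) by (simp only: coeff_pcompose_linear coeffs coeff_add rhs)
          (simp add: coeff_sum)
    next
      case 3
      then show ?thesis
        using p(1) by (simp only: coeff_pcompose_linear coeffs coeff_add rhs) (simp add: coeff_eq_0)
    qed
  qed
  finally show ?thesis .
qed

lemma geometric_multipliers_imp_monom:
  fixes q :: "nat \<Rightarrow> real poly"
  assumes "\<alpha> > 1" and up: "multiplier_sequence q (\<lambda>k. \<alpha> ^ k)"
    and down: "multiplier_sequence q (\<lambda>k. (1 / \<alpha>) ^ k)"
    and deg: "\<And>k. degree (q k) = k" and lead: "\<And>k. lead_coeff (q k) = 1"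
    and q1: "q 1 = monom 1 1"
  shows "q n = monom 1 n"
proof (induction n rule: less_induct)
  case (less n)
  consider "n = 0" | "n = 1" | "n \<ge> 2" by linarith
  then show ?case
  proof cases
    case 1
    have "q 0 = [:1:]"
      using deg[of 0] lead[of 0] by (metis degree_eq_zeroE lead_coeff_pCons(2))
    then show ?thesis using 1 by (simp add: monom_0)
  next
    case 2
    then show ?thesis using q1 by simp
  next
    case 3
    define m where "m = n - 2"
    have n: "n = m + 2" using 3 by (simp add: m_def)
    define r where "r = q n - monom 1 n"
    have r0: "coeff r k = 0" if "k \<ge> n" for k
      using that deg[of n] lead[of n] by (auto simp: r_def coeff_eq_0)
    define \<sigma> where "\<sigma> \<mu> = (\<Sum>k<n. monom ((\<mu> ^ (n - k) - 1) * coeff r k) k)" for \<mu> :: real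
    have coeff_\<sigma>: "coeff (\<sigma> \<mu>) k = (if k < n then (\<mu> ^ (n - k) - 1) * coeff r k else 0)" for \<mu> k
      by (auto simp: \<sigma>_def coeff_sum)
    (* The factor \<mu>^2 - 1 is positive for \<alpha> and negative for 1/\<alpha>. *)
    obtain \<mu> where \<mu>: "\<mu> > 0" "\<mu> \<noteq> 1" "multiplier_sequence q (\<lambda>k. \<mu> ^ k)"
      and sign: "(\<mu> ^ 2 - 1) * coeff r m \<ge> 0"
    proof (cases "coeff r m \<ge> 0")
      case True
      then have "(\<alpha> ^ 2 - 1) * coeff r m \<ge> 0"
        using \<open>\<alpha> > 1\<close> by (intro mult_nonneg_nonneg) auto
      then show ?thesis using that[of \<alpha>] \<open>\<alpha> > 1\<close> up by auto
    next
      case False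
      have "(1 / \<alpha>) ^ 2 \<le> 1"
        using \<open>\<alpha> > 1\<close> by (intro power_le_one) auto
      then have "((1 / \<alpha>) ^ 2 - 1) * coeff r m \<ge> 0"
        using False by (intro mult_nonpos_nonpos) auto
      then show ?thesis using that[of "1 / \<alpha>"] \<open>\<alpha> > 1\<close> down by auto
    qed
    have "\<sigma> \<mu> = 0"
    proof (rule real_rootedness_preserving_perturbation_eq_0)
      have "degree (\<sigma> \<mu>) \<le> m + 1"
        by (rule degree_le) (auto simp: coeff_\<sigma> n)
      then show "degree (\<sigma> \<mu>) < m + 2" by simp
      show "coeff (\<sigma> \<mu>) m \<ge> 0" using sign by (simp add: coeff_\<sigma> n)
      fix p :: "real poly"
      assume "degree p = m + 2" "lead_coeff p = 1" "only_real_zeros p"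
      then show "only_real_zeros (p + \<sigma> \<mu>)"
        unfolding \<sigma>_def using \<mu> less.IH r0 n
        by (intro geometric_multiplier_perturbs_real_rooted) (auto simp: r_def)
    qed
    have "coeff r k = 0" for k
    proof (cases "k < n")
      case True
      then have "\<mu> ^ (n - k) \<noteq> 1"
        using \<mu>(1,2) power_eq_1_iff[of \<mu> "n - k"] by auto
      then show ?thesis
        using \<open>\<sigma> \<mu> = 0\<close> coeff_\<sigma>[of \<mu> k] True by simp
    qed (use r0 in auto)
    then have "r = 0" by (intro poly_eqI) simp
    then show ?thesis by (simp add: r_def)
  qed
qed

section \<open>Affine changes of the simple set\<close>

text \<open>
  The constants \<open>c k\<close> are absorbed into the arbitrary coefficients \<open>a k\<close>, and an invertible real
  affine substitution commutes with multipliers and preserves real-rootedness both ways.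
\<close>

lemma multiplier_sequence_affine:
  assumes "multiplier_sequence b \<gamma>" and "v \<noteq> 0"
  shows "multiplier_sequence (\<lambda>k. smult (c k) (pcompose (b k) [:u, v:])) \<gamma>"
  unfolding multiplier_sequence_def
proof (intro allI impI)
  fix n a
  define S where "S g = (\<Sum>k\<le>n. smult (a k * c k * g k) (b k))" for g :: "nat \<Rightarrow> real"
  have S: "(\<Sum>k\<le>n. smult (a k * g k) (smult (c k) (pcompose (b k) [:u, v:]))) =
      pcompose (S g) [:u, v:]" for g
    by (simp add: S_def pcompose_sum pcompose_smult mult_ac)
  assume "only_real_zeros (\<Sum>k\<le>n. smult (a k) (smult (c k) (pcompose (b k) [:u, v:])))"
  then have "only_real_zeros (pcompose (S (\<lambda>_. 1)) [:u, v:])"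
    using S[of "\<lambda>_. 1"] by simp
  then have "only_real_zeros (pcompose (pcompose (S (\<lambda>_. 1)) [:u, v:]) [:- u / v, 1 / v:])"
    by (rule only_real_zeros_pcompose_linear) (use \<open>v \<noteq> 0\<close> in simp)
  moreover have "pcompose [:u, v:] [:- u / v, 1 / v:] = [:0, 1:]"
    using \<open>v \<noteq> 0\<close> by (simp add: pcompose_pCons)
  ultimately have "only_real_zeros (S (\<lambda>_. 1))"
    by (simp only: pcompose_assoc[symmetric] pcompose_idR)
  then have "only_real_zeros (S \<gamma>)"
    using assms(1) by (simp add: multiplier_sequence_def S_def)
  then show "only_real_zeros (\<Sum>k\<le>n. smult (a k * \<gamma> k) (smult (c k) (pcompose (b k) [:u, v:])))"
    unfolding S using \<open>v \<noteq> 0\<close> by (rule only_real_zeros_pcompose_linear)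
qed

lemma classical_multiplier_sequence_power:
  assumes "\<mu> \<noteq> 0"
  shows "classical_multiplier_sequence (\<lambda>k. \<mu> ^ k)"
  unfolding classical_multiplier_sequence_def multiplier_sequence_def
proof (intro allI impI)
  fix n a
  assume "only_real_zeros (\<Sum>k\<le>n. smult (a k) (monom 1 k))"
  then have "only_real_zeros (pcompose (\<Sum>k\<le>n. smult (a k) (monom 1 k)) [:0, \<mu>:])"
    using assms by (rule only_real_zeros_pcompose_linear)
  also have "pcompose (\<Sum>k\<le>n. smult (a k) (monom 1 k)) [:0, \<mu>:] =
      (\<Sum>k\<le>n. smult (a k * \<mu> ^ k) (monom 1 k))"
    by (rule poly_eqI) (simp add: coeff_pcompose_linear coeff_sum smult_monom)
  finally show "only_real_zeros (\<Sum>k\<le>n. smult (a k * \<mu> ^ k) (monom 1 k))" .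
qed

section \<open>The characterisation\<close>

theorem theorem4:
  fixes b :: "nat \<Rightarrow> real poly"
  assumes "simple_set b"
  shows "{\<gamma>. multiplier_sequence b \<gamma>} = {\<gamma>. classical_multiplier_sequence \<gamma>} \<longleftrightarrow>
    (\<exists>\<alpha>::real. \<alpha> > 1 \<and>
       multiplier_sequence b (\<lambda>k. \<alpha> ^ k) \<and>
       multiplier_sequence b (\<lambda>k. (1 / \<alpha>) ^ k))"
proof
  assume "{\<gamma>. multiplier_sequence b \<gamma>} = {\<gamma>. classical_multiplier_sequence \<gamma>}"
  then have eq: "multiplier_sequence b \<gamma> \<longleftrightarrow> classical_multiplier_sequence \<gamma>" for \<gamma> by blast
  show "\<exists>\<alpha>::real. \<alpha> > 1 \<and> multiplier_sequence b (\<lambda>k. \<alpha> ^ k) \<and>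
       multiplier_sequence b (\<lambda>k. (1 / \<alpha>) ^ k)"
    unfolding eq by (intro exI[of _ 2] conjI classical_multiplier_sequence_power) auto
next
  assume "\<exists>\<alpha>::real. \<alpha> > 1 \<and> multiplier_sequence b (\<lambda>k. \<alpha> ^ k) \<and>
       multiplier_sequence b (\<lambda>k. (1 / \<alpha>) ^ k)"
  then obtain \<alpha> :: real where \<alpha>: "\<alpha> > 1" "multiplier_sequence b (\<lambda>k. \<alpha> ^ k)"
    "multiplier_sequence b (\<lambda>k. (1 / \<alpha>) ^ k)" by blast
  define c where "c k = lead_coeff (b k)" for k
  have deg: "degree (b k) = k" for k
    using assms by (simp add: simple_set_def)
  have c: "c k \<noteq> 0" for k
    using assms unfolding c_def leading_coeff_0_iff by (simp add: simple_set_def)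
  (* The zero of b 1; moving it to the origin turns b 1 into a multiple of x. *)
  define u where "u = - coeff (b 1) 0 / c 1"
  define q where "q k = smult (1 / c k) (pcompose (b k) [:u, 1:])" for k
  have deg_q: "degree (q k) = k" for k
    using c[of k] by (simp add: q_def degree_pcompose deg)
  have lead_q: "lead_coeff (q k) = 1" for k
  proof -
    have "lead_coeff (pcompose (b k) [:u, 1:]) = c k"
      by (subst lead_coeff_comp) (simp_all add: c_def)
    then show ?thesis using c[of k] by (simp add: q_def)
  qed
  have "b 1 = [:coeff (b 1) 0, c 1:]"
    using deg[of 1] by (intro poly_eqI) (auto simp: c_def coeff_pCons coeff_eq_0 split: nat.split)
  moreover have "pcompose [:d, e:] [:- d / e, 1:] = smult e (monom 1 1)" if "e \<noteq> 0" for d e :: real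
    using that by (simp add: pcompose_pCons monom_altdef)
  ultimately have "pcompose (b 1) [:u, 1:] = smult (c 1) (monom 1 1)"
    using c[of 1] unfolding u_def by metis
  then have q1: "q 1 = monom 1 1" using c[of 1] by (simp add: q_def)
  have to_q: "multiplier_sequence q \<gamma>" if "multiplier_sequence b \<gamma>" for \<gamma>
    using multiplier_sequence_affine[OF that, of 1 "\<lambda>k. 1 / c k" u] by (simp add: q_def[abs_def])
  have q: "q = (\<lambda>k. monom 1 k)"
    using geometric_multipliers_imp_monom[OF \<alpha>(1) to_q[OF \<alpha>(2)] to_q[OF \<alpha>(3)] deg_q lead_q q1]
    by (rule ext)
  have from_q: "multiplier_sequence b \<gamma>" if "multiplier_sequence q \<gamma>" for \<gamma>
  proof -
    have "smult (c k) (pcompose (q k) [:- u, 1:]) = b k" for k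
      using c[of k]
      by (simp add: q_def pcompose_smult pcompose_assoc[symmetric] pcompose_pCons)
    then show ?thesis
      using multiplier_sequence_affine[OF that, of 1 c "- u"] by simp
  qed
  have "multiplier_sequence b \<gamma> \<longleftrightarrow> classical_multiplier_sequence \<gamma>" for \<gamma>
    using to_q from_q unfolding classical_multiplier_sequence_def q by blast
  then show "{\<gamma>. multiplier_sequence b \<gamma>} = {\<gamma>. classical_multiplier_sequence \<gamma>}"
    by blast
qed

end
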